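(* Let $0<\alpha\le \pi/2$, let $\Delta=\Delta(\alpha)=\{re^{i\theta} : r\ge 0,\ |\theta|\le\alpha\}$, let $1\le p<\infty$, let $\rho:\Delta\to\mathbb{R}_+$ be an admissible weight function, and let $\{T_t\}_{t\in\Delta}$ be the translation semigroup on $X=L^p_\rho(\Delta,\mathbb{K})$. If $\{T_t\}_{t\in\Delta}$ is frequently hypercyclic, then for any $\epsilon>0$ the set $\{t\in\Delta : \rho(t)\le\epsilon\}$ is a thick $\mathcal{F}_{pld}$-set in $\Delta$.
   Context: $\mathbb{K}$ is the scalar field $\mathbb{R}$ or $\mathbb{C}$. A function $\rho:\Delta\to\mathbb{R}_+$ is an admissible weight function if it is measurable and there exist constants $M\ge 1$ and $\omega\in\mathbb{R}$ such that $\rho(t)\le Me^{\omega|t'|}\rho(t+t')$ for all $t,t'\in\Delta$. The space $L^p_\rho(\Delta,\mathbb{K})$ consists of the (classes of) measurable $u:\Delta\to\mathbb{K}$ with $$\|u\|_p=\left(\int_\Delta|u(\tau)|^p\rho(\tau)\,d\tau\right)^{1/p}<\infty,$$ integration being with respect to Lebesgue measure on the plane. The translation semigroup on $L^p_\rho(\Delta,\mathbb{K})$ is $(T_tf)(x):=f(x+t)$, $x,t\in\Delta$; admissibility of $\rho$ ensures that it is a well-defined $C_0$-semigroup, i.e. a family of bounded linear operators with $T_0=I$, $T_{t+s}=T_tT_s$ for all $s,t\in\Delta$, and $\lim_{s\to t}T_sf=T_tf$ for all $f\in X$, $t\in\Delta$. Let $m$ be Lebesgue measure on the plane and $\Delta_t:=\{s\in\Delta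 : |s|\le t\}$ for $t>0$. The lower density of a measurable set $A\subset\Delta$ is $$\underline{D}(A):=\liminf_{t\to\infty}\frac{m(A\cap\Delta_t)}{m(\Delta_t)}=\liminf_{t\to\infty}\frac{m(A\cap\Delta_t)}{\alpha t^2}.$$ A $C_0$-semigroup $\{T_t\}_{t\in\Delta}$ on a Banach space $X$ is frequently hypercyclic if there exists $x\in X$ such that $\underline{D}(\{t\in\Delta : T_tx\in U\})>0$ for every non-empty open set $U\subset X$. $\mathcal{F}_{pld}:=\{A\subset\Delta : \underline{D}(A)>0\}$ is the family of all subsets of $\Delta$ having positive lower density. A subset $A\subset\Delta$ is a thick $\mathcal{F}_{pld}$-set if for any compact subset $K\subset\Delta$ there exists $B\in\mathcal{F}_{pld}$ such that $K+B\subset A$. *)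

theory Defs
  imports "HOL-Analysis.Analysis"
begin

definition sector :: "real \<Rightarrow> complex set" where
  "sector \<alpha> = {of_real r * cis \<theta> | r \<theta>. 0 \<le> r \<and> \<bar>\<theta>\<bar> \<le> \<alpha>}"

(* Weights and function classes live on all of complex; only their values on D matter.
   Weights are allowed to vanish. *)
definition admissible_weight :: "complex set \<Rightarrow> (complex \<Rightarrow> real) \<Rightarrow> bool" where
  "admissible_weight D \<rho> \<longleftrightarrow>
     \<rho> \<in> borel_measurable (lebesgue_on D) \<and> (\<forall>t\<in>D. 0 \<le> \<rho> t) \<and>
     (\<exists>M \<omega>. 1 \<le> M \<and> (\<forall>t\<in>D. \<forall>t'\<in>D. \<rho> t \<le> M * exp (\<omega> * norm t') * \<rho> (t + t')))"

definition Lp_functions ::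
  "complex set \<Rightarrow> real \<Rightarrow> (complex \<Rightarrow> real) \<Rightarrow> (complex \<Rightarrow> 'k::{real_normed_field,euclidean_space}) set" where
  "Lp_functions D p \<rho> =
     {u. u \<in> borel_measurable (lebesgue_on D) \<and>
         integrable (lebesgue_on D) (\<lambda>x. norm (u x) powr p * \<rho> x)}"

definition Lp_norm ::
  "complex set \<Rightarrow> real \<Rightarrow> (complex \<Rightarrow> real) \<Rightarrow> (complex \<Rightarrow> 'k::{real_normed_field,euclidean_space}) \<Rightarrow> real" where
  "Lp_norm D p \<rho> u = (LINT x|lebesgue_on D. norm (u x) powr p * \<rho> x) powr (1 / p)"

(* Equality almost everywhere with respect to the measure with density \<rho>. If \<rho> is positive
   on D this is equality Lebesgue-almost everywhere on D; in general it is what makes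
   Lp_norm a norm on the classes. *)
definition Lp_rel ::
  "complex set \<Rightarrow> real \<Rightarrow> (complex \<Rightarrow> real) \<Rightarrow>
   ((complex \<Rightarrow> 'k::{real_normed_field,euclidean_space}) \<times> (complex \<Rightarrow> 'k)) set" where
  "Lp_rel D p \<rho> =
     {(u, v). u \<in> Lp_functions D p \<rho> \<and> v \<in> Lp_functions D p \<rho> \<and>
              (AE x in lebesgue_on D. \<rho> x \<noteq> 0 \<longrightarrow> u x = v x)}"

definition Lp_space ::
  "complex set \<Rightarrow> real \<Rightarrow> (complex \<Rightarrow> real) \<Rightarrow> (complex \<Rightarrow> 'k::{real_normed_field,euclidean_space}) set set" where
  "Lp_space D p \<rho> = Lp_functions D p \<rho> // Lp_rel D p \<rho>"

(* Metric_space requires symmetry and nonnegativity also off the carrier, hence the default value. *)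
definition Lp_dist ::
  "complex set \<Rightarrow> real \<Rightarrow> (complex \<Rightarrow> real) \<Rightarrow>
   (complex \<Rightarrow> 'k::{real_normed_field,euclidean_space}) set \<Rightarrow> (complex \<Rightarrow> 'k) set \<Rightarrow> real" where
  "Lp_dist D p \<rho> F G =
     (if F \<in> Lp_space D p \<rho> \<and> G \<in> Lp_space D p \<rho>
      then the_elem (\<Union>f\<in>F. \<Union>g\<in>G. {Lp_norm D p \<rho> (\<lambda>x. f x - g x)}) else 0)"

lemma powr_add_le_convex:
  fixes a b x y p :: real
  assumes "1 \<le> p" "0 < a" "0 < b" "0 \<le> x" "0 \<le> y"
  shows "(x + y) powr p \<le> (a + b) powr p * (a / (a + b) * (x / a) powr p + b / (a + b) * (y / b) powr p)"
proof -
  have le1: "c powr p \<le> c" if "0 \<le> c" "c \<le> 1" for c :: real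
    using powr_mono'[OF assms(1) that] that(1) by simp
  have conv: "(s * u + r * v) powr p \<le> s * u powr p + r * v powr p"
    if "0 \<le> u" "0 \<le> v" and s: "0 \<le> s" "0 \<le> r" "s + r = 1" for s r u v :: real
  proof -
    have z: "(c * w) powr p \<le> c * w powr p" if "0 \<le> c" "c \<le> 1" "0 \<le> w" for c w :: real
      using mult_right_mono[OF le1[OF that(1,2)], of "w powr p"] that by (simp add: powr_mult)
    have "u = 0 \<or> v = 0 \<or> 0 < u \<and> 0 < v" using that(1,2) by linarith
    then consider "u = 0" | "v = 0" | "0 < u" "0 < v" by blast
    then show ?thesis
    proof cases
      case 1
      then show ?thesis using z[of r v] that by simp
    next
      case 2
      then show ?thesis using z[of s u] that by simp
    next
      case 3
      have "s = 1 - r" using s(3) by linarith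
      with convex_onD[OF powr_convex[OF assms(1)], of r u v] 3 s(1,2) that(1,2) show ?thesis
        by (simp only: real_scaleR_def) force
    qed
  qed
  define s where "s = a / (a + b)"
  define r where "r = b / (a + b)"
  have sr: "0 \<le> s" "0 \<le> r" "s + r = 1"
    using assms(2,3) by (simp_all add: s_def r_def add_divide_distrib[symmetric])
  have abs: "(a + b) * s = a" "(a + b) * r = b" using assms(2,3) by (simp_all add: s_def r_def)
  have "(a + b) * (s * (x / a) + r * (y / b)) = ((a + b) * s) * (x / a) + ((a + b) * r) * (y / b)"
    by (simp only: distrib_left mult.assoc)
  also have "\<dots> = x + y" unfolding abs using assms(2,3) by simp
  finally have eq: "(a + b) * (s * (x / a) + r * (y / b)) = x + y" .
  have nn: "0 \<le> s * (x / a) + r * (y / b)"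
    using sr assms by (intro add_nonneg_nonneg mult_nonneg_nonneg divide_nonneg_pos)
  have "(x + y) powr p = (a + b) powr p * (s * (x / a) + r * (y / b)) powr p"
    using powr_mult[of "a + b" "s * (x / a) + r * (y / b)" p] unfolding eq using nn assms(2,3) by simp
  also have "\<dots> \<le> (a + b) powr p * (s * (x / a) powr p + r * (y / b) powr p)"
    using assms sr by (intro mult_left_mono conv divide_nonneg_pos) auto
  finally show ?thesis unfolding s_def r_def .
qed

context
  fixes D :: "complex set" and p :: real and \<rho> :: "complex \<Rightarrow> real"
  assumes p: "1 \<le> p" and \<rho>: "\<rho> \<in> borel_measurable (lebesgue_on D)" "\<And>x. x \<in> D \<Longrightarrow> 0 \<le> \<rho> x"
begin

lemma weight_nonneg_space: "x \<in> space (lebesgue_on D) \<Longrightarrow> 0 \<le> \<rho> x" using \<rho>(2) by simp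

lemma Lp_functions_diff_bound:
  fixes f g :: "complex \<Rightarrow> 'k::{real_normed_field,euclidean_space}"
  assumes f: "f \<in> Lp_functions D p \<rho>" and g: "g \<in> Lp_functions D p \<rho>" and ab: "0 < a" "0 < b"
  defines "I \<equiv> \<lambda>h::complex \<Rightarrow> 'k. LINT x|lebesgue_on D. norm (h x) powr p * \<rho> x"
  shows "(\<lambda>x. f x - g x) \<in> Lp_functions D p \<rho>"
    "I (\<lambda>x. f x - g x) \<le> (a + b) powr p * (a / (a + b) * (I f / a powr p) + b / (a + b) * (I g / b powr p))"
proof -
  let ?M = "lebesgue_on D"
  have [measurable]: "f \<in> borel_measurable ?M" "g \<in> borel_measurable ?M" "\<rho> \<in> borel_measurable ?M"
    using f g \<rho> by (auto simp: Lp_functions_def)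
  let ?B = "\<lambda>x. (a + b) powr p * (a / (a + b) * ((norm (f x) powr p * \<rho> x) / a powr p) + b / (a + b) * ((norm (g x) powr p * \<rho> x) / b powr p))"
  have intf: "integrable ?M (\<lambda>x. norm (f x) powr p * \<rho> x)" "integrable ?M (\<lambda>x. norm (g x) powr p * \<rho> x)"
    using f g by (auto simp: Lp_functions_def)
  have B: "integrable ?M ?B" using intf by auto
  have le: "norm (f x - g x) powr p * \<rho> x \<le> ?B x" if "x \<in> space ?M" for x
  proof -
    have "norm (f x - g x) powr p \<le> (norm (f x) + norm (g x)) powr p"
      using p by (intro powr_mono2 norm_triangle_ineq4) auto
    also note powr_add_le_convex[OF p ab, of "norm (f x)" "norm (g x)"]
    finally have "norm (f x - g x) powr p * \<rho> x \<le> ((a + b) powr p * (a / (a + b) * (norm (f x) / a) powr p + b / (a + b) * (norm (g x) / b) powr p)) * \<rho> x"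
      using weight_nonneg_space[OF that] by (intro mult_right_mono) auto
    also have "\<dots> = ?B x" using ab by (simp add: powr_divide algebra_simps)
    finally show ?thesis .
  qed
  have int: "integrable ?M (\<lambda>x. norm (f x - g x) powr p * \<rho> x)"
    by (rule Bochner_Integration.integrable_bound[OF B]) (use le weight_nonneg_space in \<open>auto intro!: AE_I2 order_trans[OF _ abs_ge_self]\<close>)
  then show "(\<lambda>x. f x - g x) \<in> Lp_functions D p \<rho>" by (simp add: Lp_functions_def)
  have "I (\<lambda>x. f x - g x) \<le> (LINT x|?M. ?B x)"
    unfolding I_def by (rule integral_mono[OF int B le])
  also have "\<dots> = (a + b) powr p * (a / (a + b) * (I f / a powr p) + b / (a + b) * (I g / b powr p))"
    unfolding I_def using intf by simp
  finally show "I (\<lambda>x. f x - g x) \<le> (a + b) powr p * (a / (a + b) * (I f / a powr p) + b / (a + b) * (I g / b powr p))" .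
qed

lemma Lp_norm_diff_le:
  fixes f g :: "complex \<Rightarrow> 'k::{real_normed_field,euclidean_space}"
  assumes f: "f \<in> Lp_functions D p \<rho>" and g: "g \<in> Lp_functions D p \<rho>"
  shows "Lp_norm D p \<rho> (\<lambda>x. f x - g x) \<le> Lp_norm D p \<rho> f + Lp_norm D p \<rho> g"
proof (rule field_le_epsilon)
  fix e :: real assume e: "0 < e"
  define I where "I = (\<lambda>h::complex \<Rightarrow> 'k. LINT x|lebesgue_on D. norm (h x) powr p * \<rho> x)"
  have I0: "0 \<le> I h" for h unfolding I_def using weight_nonneg_space by (intro integral_nonneg_AE AE_I2) auto
  define a where "a = Lp_norm D p \<rho> f + e / 2"
  define b where "b = Lp_norm D p \<rho> g + e / 2"
  have ab: "0 < a" "0 < b" using e by (auto simp: a_def b_def Lp_norm_def add_nonneg_pos)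
  have Ile: "I h \<le> (Lp_norm D p \<rho> h + e / 2) powr p" for h
  proof -
    have "I h = Lp_norm D p \<rho> h powr p" using p I0[of h] by (simp add: powr_powr Lp_norm_def I_def)
    also have "\<dots> \<le> (Lp_norm D p \<rho> h + e / 2) powr p" using e p by (intro powr_mono2) (auto simp: Lp_norm_def)
    finally show ?thesis .
  qed
  have "I (\<lambda>x. f x - g x) \<le> (a + b) powr p * (a / (a + b) * (I f / a powr p) + b / (a + b) * (I g / b powr p))"
    using Lp_functions_diff_bound(2)[OF f g ab] unfolding I_def .
  also have "\<dots> \<le> (a + b) powr p * (a / (a + b) * 1 + b / (a + b) * 1)"
    using Ile[of f] Ile[of g] ab by (intro mult_left_mono add_mono) (auto simp: a_def b_def divide_le_eq)
  also have "a / (a + b) * 1 + b / (a + b) * 1 = 1" using ab by (simp add: add_divide_distrib[symmetric])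
  finally have "I (\<lambda>x. f x - g x) powr (1 / p) \<le> ((a + b) powr p) powr (1 / p)"
    using p I0 by (intro powr_mono2) auto
  also have "\<dots> = a + b" using p ab by (simp add: powr_powr)
  finally show "Lp_norm D p \<rho> (\<lambda>x. f x - g x) \<le> Lp_norm D p \<rho> f + Lp_norm D p \<rho> g + e"
    unfolding Lp_norm_def I_def[symmetric] a_def b_def by (simp add: Lp_norm_def I_def)
qed

lemma Lp_norm_cong:
  assumes "AE x in lebesgue_on D. \<rho> x \<noteq> 0 \<longrightarrow> norm (u x) = norm (v x)"
    "u \<in> borel_measurable (lebesgue_on D)" "v \<in> borel_measurable (lebesgue_on D)"
  shows "Lp_norm D p \<rho> u = Lp_norm D p \<rho> v"
  unfolding Lp_norm_def using assms \<rho>(1)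
  by (auto intro!: arg_cong[where f = "\<lambda>x. x powr _"] integral_cong_AE elim!: AE_mp)

lemma Lp_norm_eq_0_iff:
  assumes "u \<in> Lp_functions D p \<rho>"
  shows "Lp_norm D p \<rho> u = 0 \<longleftrightarrow> (AE x in lebesgue_on D. \<rho> x \<noteq> 0 \<longrightarrow> u x = 0)"
proof -
  have "Lp_norm D p \<rho> u = 0 \<longleftrightarrow> (LINT x|lebesgue_on D. norm (u x) powr p * \<rho> x) = 0"
    by (simp add: Lp_norm_def)
  also have "\<dots> \<longleftrightarrow> (AE x in lebesgue_on D. norm (u x) powr p * \<rho> x = 0)"
    using assms weight_nonneg_space by (intro integral_nonneg_eq_0_iff_AE AE_I2) (auto simp: Lp_functions_def)
  also have "\<dots> \<longleftrightarrow> (AE x in lebesgue_on D. \<rho> x \<noteq> 0 \<longrightarrow> u x = 0)" 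
    by (intro AE_cong) auto
  finally show ?thesis .
qed

lemma equiv_Lp_rel: "equiv (Lp_functions D p \<rho>) (Lp_rel D p \<rho>)"
  unfolding equiv_def
proof (intro conjI)
  show "Lp_rel D p \<rho> \<subseteq> Lp_functions D p \<rho> \<times> Lp_functions D p \<rho>" by (auto simp: Lp_rel_def)
  show "refl_on (Lp_functions D p \<rho>) (Lp_rel D p \<rho>)" by (auto simp: refl_on_def Lp_rel_def)
  show "sym (Lp_rel D p \<rho>)" by (auto simp: sym_def Lp_rel_def elim!: AE_mp)
  show "trans (Lp_rel D p \<rho>)"
    unfolding trans_def Lp_rel_def by auto
qed

lemma Lp_functions_measurable: "f \<in> Lp_functions D p \<rho> \<Longrightarrow> f \<in> borel_measurable (lebesgue_on D)"
  by (simp add: Lp_functions_def)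

lemma Lp_dist_eq:
  fixes f g :: "complex \<Rightarrow> 'k::{real_normed_field,euclidean_space}"
  assumes F: "F \<in> Lp_space D p \<rho>" and G: "G \<in> Lp_space D p \<rho>" and f: "f \<in> F" and g: "g \<in> G"
  shows "Lp_dist D p \<rho> F G = Lp_norm D p \<rho> (\<lambda>x. f x - g x)"
proof -
  have "Lp_norm D p \<rho> (\<lambda>x. f' x - g' x) = Lp_norm D p \<rho> (\<lambda>x. f x - g x)" if "f' \<in> F" "g' \<in> G" for f' g'
  proof -
    have "(f, f') \<in> Lp_rel D p \<rho>" "(g, g') \<in> Lp_rel D p \<rho>"
      using F G f g that quotient_eq_iff[OF equiv_Lp_rel] unfolding Lp_space_def by blast+
    then have r: "AE x in lebesgue_on D. \<rho> x \<noteq> 0 \<longrightarrow> f x = f' x" "AE x in lebesgue_on D. \<rho> x \<noteq> 0 \<longrightarrow> g x = g' x"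
       and m: "f \<in> Lp_functions D p \<rho>" "f' \<in> Lp_functions D p \<rho>" "g \<in> Lp_functions D p \<rho>" "g' \<in> Lp_functions D p \<rho>"
      by (auto simp: Lp_rel_def)
    from r show ?thesis using m[THEN Lp_functions_measurable]
      by (intro Lp_norm_cong) auto
  qed
  then have "(\<Union>f\<in>F. \<Union>g\<in>G. {Lp_norm D p \<rho> (\<lambda>x. f x - g x)}) = {Lp_norm D p \<rho> (\<lambda>x. f x - g x)}"
    using f g by blast
  then show ?thesis using F G by (simp add: Lp_dist_def)
qed

lemma Lp_dist_properties:
  fixes F G H :: "(complex \<Rightarrow> 'k::{real_normed_field,euclidean_space}) set"
  assumes F: "F \<in> Lp_space D p \<rho>" and G: "G \<in> Lp_space D p \<rho>" and H: "H \<in> Lp_space D p \<rho>"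
  shows "Lp_dist D p \<rho> F G = 0 \<longleftrightarrow> F = G" "Lp_dist D p \<rho> F G = Lp_dist D p \<rho> G F"
     "Lp_dist D p \<rho> F H \<le> Lp_dist D p \<rho> F G + Lp_dist D p \<rho> G H" "0 \<le> Lp_dist D p \<rho> F G"
proof -
  note q = F[unfolded Lp_space_def] G[unfolded Lp_space_def] H[unfolded Lp_space_def]
  obtain f where f: "f \<in> F" using in_quotient_imp_non_empty[OF equiv_Lp_rel q(1)] by auto
  obtain g where g: "g \<in> G" using in_quotient_imp_non_empty[OF equiv_Lp_rel q(2)] by auto
  obtain h where h: "h \<in> H" using in_quotient_imp_non_empty[OF equiv_Lp_rel q(3)] by auto
  note fgh = f g h
  have L: "f \<in> Lp_functions D p \<rho>" "g \<in> Lp_functions D p \<rho>" "h \<in> Lp_functions D p \<rho>"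
    using in_quotient_imp_subset[OF equiv_Lp_rel q(1)] in_quotient_imp_subset[OF equiv_Lp_rel q(2)]
      in_quotient_imp_subset[OF equiv_Lp_rel q(3)] fgh by auto
  note m = L[THEN Lp_functions_measurable]
  have "F = G \<longleftrightarrow> (f, g) \<in> Lp_rel D p \<rho>"
    by (rule quotient_eq_iff[OF equiv_Lp_rel q(1,2) f g])
  then show "Lp_dist D p \<rho> F G = 0 \<longleftrightarrow> F = G"
    unfolding Lp_dist_eq[OF F G fgh(1,2)] using L Lp_norm_eq_0_iff[OF Lp_functions_diff_bound(1)[OF L(1,2) zero_less_one zero_less_one]]
    by (simp add: Lp_rel_def)
  show "Lp_dist D p \<rho> F G = Lp_dist D p \<rho> G F"
    unfolding Lp_dist_eq[OF F G fgh(1,2)] Lp_dist_eq[OF G F fgh(2,1)]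
    using m by (intro Lp_norm_cong) (auto simp: norm_minus_commute)
  have fg: "(\<lambda>x. f x - g x) \<in> Lp_functions D p \<rho>" and hg: "(\<lambda>x. h x - g x) \<in> Lp_functions D p \<rho>"
    by (rule Lp_functions_diff_bound(1)[OF L(1,2) zero_less_one zero_less_one],
        rule Lp_functions_diff_bound(1)[OF L(3,2) zero_less_one zero_less_one])
  have "Lp_norm D p \<rho> (\<lambda>x. h x - g x) = Lp_norm D p \<rho> (\<lambda>x. g x - h x)"
    using m by (intro Lp_norm_cong) (auto simp: norm_minus_commute)
  then show "Lp_dist D p \<rho> F H \<le> Lp_dist D p \<rho> F G + Lp_dist D p \<rho> G H"
    unfolding Lp_dist_eq[OF F G fgh(1,2)] Lp_dist_eq[OF F H fgh(1,3)] Lp_dist_eq[OF G H fgh(2,3)]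
    using Lp_norm_diff_le[OF fg hg] by simp
  show "0 \<le> Lp_dist D p \<rho> F G" unfolding Lp_dist_eq[OF F G fgh(1,2)] by (simp add: Lp_norm_def)
qed


lemma Metric_space_Lp:
  "Metric_space (Lp_space D p \<rho> :: (complex \<Rightarrow> 'k::{real_normed_field,euclidean_space}) set set) (Lp_dist D p \<rho>)"
proof (rule Metric_space.intro)
  fix F G H :: "(complex \<Rightarrow> 'k) set"
  show "0 \<le> Lp_dist D p \<rho> F G"
  proof (cases "F \<in> Lp_space D p \<rho> \<and> G \<in> Lp_space D p \<rho>")
    case True
    then show ?thesis using Lp_dist_properties(4)[of F G F] by simp
  next
    case False
    then show ?thesis by (simp only: Lp_dist_def if_False order_refl)
  qed
  show "Lp_dist D p \<rho> F G = Lp_dist D p \<rho> G F"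
  proof (cases "F \<in> Lp_space D p \<rho> \<and> G \<in> Lp_space D p \<rho>")
    case True
    then show ?thesis using Lp_dist_properties(2)[of F G F] by simp
  next
    case False
    then have "\<not> (G \<in> Lp_space D p \<rho> \<and> F \<in> Lp_space D p \<rho>)" by blast
    with False show ?thesis by (simp only: Lp_dist_def if_False)
  qed
  assume F: "F \<in> Lp_space D p \<rho>" and G: "G \<in> Lp_space D p \<rho>"
  show "Lp_dist D p \<rho> F G = 0 \<longleftrightarrow> F = G"
    using Lp_dist_properties(1)[OF F G F] .
  assume H: "H \<in> Lp_space D p \<rho>"
  show "Lp_dist D p \<rho> F H \<le> Lp_dist D p \<rho> F G + Lp_dist D p \<rho> G H"
    using Lp_dist_properties(3)[OF F G H] .
qed

end

definition Lp_topology ::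
  "complex set \<Rightarrow> real \<Rightarrow> (complex \<Rightarrow> real) \<Rightarrow>
   (complex \<Rightarrow> 'k::{real_normed_field,euclidean_space}) set topology" where
  "Lp_topology D p \<rho> = Metric_space.mtopology (Lp_space D p \<rho>) (Lp_dist D p \<rho>)"

definition translation ::
  "complex set \<Rightarrow> real \<Rightarrow> (complex \<Rightarrow> real) \<Rightarrow> complex \<Rightarrow>
   (complex \<Rightarrow> 'k::{real_normed_field,euclidean_space}) set \<Rightarrow> (complex \<Rightarrow> 'k) set" where
  "translation D p \<rho> t F = (\<Union>f\<in>F. Lp_rel D p \<rho> `` {\<lambda>x. f (x + t)})"

definition lower_density :: "complex set \<Rightarrow> complex set \<Rightarrow> ereal" where
  "lower_density D A =
     Liminf at_top (\<lambda>r::real. ereal (measure lebesgue (A \<inter> {s \<in> D. norm s \<le> r}) /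
                                     measure lebesgue {s \<in> D. norm s \<le> r}))"

(* The set of return times is Lebesgue measurable whenever T is a strongly continuous
   semigroup, so that its lower density is meaningful. *)
definition frequently_hypercyclic ::
  "complex set \<Rightarrow> 'x topology \<Rightarrow> (complex \<Rightarrow> 'x \<Rightarrow> 'x) \<Rightarrow> bool" where
  "frequently_hypercyclic D X T \<longleftrightarrow>
     (\<exists>x\<in>topspace X. \<forall>U. openin X U \<and> U \<noteq> {} \<longrightarrow> 0 < lower_density D {t \<in> D. T t x \<in> U})"

definition pos_lower_density_sets :: "complex set \<Rightarrow> complex set set" where
  "pos_lower_density_sets D = {A. A \<subseteq> D \<and> A \<in> sets lebesgue \<and> 0 < lower_density D A}"

definition thick_pld_set :: "complex set \<Rightarrow> complex set \<Rightarrow> bool" where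
  "thick_pld_set D A \<longleftrightarrow>
     A \<subseteq> D \<and>
     (\<forall>K. compact K \<and> K \<subseteq> D \<longrightarrow>
        (\<exists>B\<in>pos_lower_density_sets D. {k + b | k b. k \<in> K \<and> b \<in> B} \<subseteq> A))"

end

theory Submission
  imports Defs
begin

text \<open>
  Let \<open>u\<close> be a function whose translates visit every open set with positive lower density, and
  let \<open>K\<close> be a compact subset of the cone. The target chosen for the orbit is the unit ball around
  a plateau \<open>v\<close>: the function with constant value \<open>c\<close> on a large disc and \<open>0\<close> outside it. If the
  translate of \<open>u\<close> by \<open>t\<close> is within distance 1 of \<open>v\<close>, then \<open>\<bar>u\<bar>\<close> has size about \<open>c\<close> on most
  of the disc moved by \<open>t\<close>. The height \<open>c\<close> is arbitrary while the norm of \<open>u\<close> is fixed, so the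
  weight must be small near \<open>k + t\<close> for every \<open>k\<close> in \<open>K\<close>. A weight above \<open>\<epsilon>\<close> at \<open>k + t\<close> would,
  by admissibility, stay above a fixed multiple of \<open>\<epsilon>\<close> on a whole disc slightly further out in the
  cone, and \<open>translate_near_plateau_bound\<close> then bounds \<open>c\<close> by a quantity that depends only on the
  weight, \<open>K\<close>, \<open>\<epsilon>\<close> and the norm of \<open>u\<close>. A sufficiently high plateau contradicts this, so the
  return times to the ball form a set \<open>B\<close> of positive lower density with \<open>K + B\<close> inside the
  sublevel set.

  Two points need care. A weight may vanish on part of the cone, and there closeness in norm says
  nothing about the values of a function. If the weight is positive at a point \<open>s\<close>, it is bounded
  below on bounded parts of \<open>s + D\<close>, so all comparisons take place on discs inside \<open>k + s + D\<close>;
  if there is no such \<open>s\<close>, every point of the cone is in the sublevel set. The set \<open>B\<close> must also be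
  measurable, and this follows from its positive lower density
  (\<open>lower_density_pos_imp_measurable\<close>).

  The argument applies to every measurable convex cone with nonempty interior; sectors of half-angle
  at most a right angle are of this kind.
\<close>

section \<open>Lebesgue measure\<close>

lemma distr_lebesgue_translation:
  fixes t :: "'a::euclidean_space"
  shows "(\<lambda>x. x + t) \<in> measurable lebesgue lebesgue"
    and "distr lebesgue lebesgue (\<lambda>x. x + t) = lebesgue"
proof -
  have vimage: "(\<lambda>x. x + t) -` A = (\<lambda>x. - t + x) ` A" for A
  proof (intro set_eqI iffI)
    fix x assume "x \<in> (\<lambda>x. x + t) -` A"
    then show "x \<in> (\<lambda>x. - t + x) ` A"
      by (intro image_eqI[of _ _ "x + t"]) auto
  qed auto
  show meas: "(\<lambda>x. x + t) \<in> measurable lebesgue lebesgue"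
  proof (rule measurableI)
    fix A :: "'a set" assume "A \<in> sets lebesgue"
    then show "(\<lambda>x. x + t) -` A \<inter> space lebesgue \<in> sets lebesgue"
      using lebesgue_sets_translation[of A "- t"] unfolding vimage by simp
  qed simp
  show "distr lebesgue lebesgue (\<lambda>x. x + t) = lebesgue"
  proof (rule measure_eqI)
    fix A :: "'a set" assume "A \<in> sets (distr lebesgue lebesgue (\<lambda>x. x + t))"
    then have "emeasure (distr lebesgue lebesgue (\<lambda>x. x + t)) A = emeasure lebesgue ((\<lambda>x. - t + x) ` A)"
      by (simp add: emeasure_distr meas vimage)
    also have "\<dots> = emeasure lebesgue A"
      using emeasure_lebesgue_affine[of 1 "- t" A] by (simp add: add.commute cong: image_cong_simp)
    finally show "emeasure (distr lebesgue lebesgue (\<lambda>x. x + t)) A = emeasure lebesgue A" .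
  qed simp
qed

lemma nn_integral_lebesgue_translation:
  fixes t :: "'a::euclidean_space"
  assumes "g \<in> borel_measurable lebesgue"
  shows "(\<integral>\<^sup>+x. g (x + t) \<partial>lebesgue) = (\<integral>\<^sup>+x. g x \<partial>lebesgue)"
  using nn_integral_distr[OF distr_lebesgue_translation(1), of g t] assms
  by (simp add: distr_lebesgue_translation(2))

text \<open>
  The lower density is computed with a measure that assigns \<open>0\<close> to sets that are not measurable, so
  if it is positive then the intersection with every large disc is measurable.
\<close>

lemma lower_density_pos_imp_measurable:
  assumes "0 < lower_density D A" "A \<subseteq> D"
  shows "A \<in> sets lebesgue"
proof -
  let ?A = "\<lambda>r::real. A \<inter> {s \<in> D. norm s \<le> r}"
  have "\<forall>\<^sub>F r in at_top. 0 < ereal (measure lebesgue (?A r) / measure lebesgue {s \<in> D. norm s \<le> r})"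
    using less_LiminfD[OF assms(1)[unfolded lower_density_def]] .
  then have "\<forall>\<^sub>F r in at_top. ?A r \<in> sets lebesgue"
  proof eventually_elim
    case (elim r)
    then have "measure lebesgue (?A r) \<noteq> 0" by (intro notI) simp
    then show ?case using measure_notin_sets[of "?A r" lebesgue] by blast
  qed
  then obtain N where N: "\<And>r. N \<le> r \<Longrightarrow> ?A r \<in> sets lebesgue"
    by (auto simp: eventually_at_top_linorder)
  have "A = (\<Union>n::nat. ?A (N + real n))"
  proof -
    have "\<exists>n::nat. norm x \<le> N + real n" for x :: complex
      using real_arch_simple[of "norm x - N"] by (auto simp: algebra_simps)
    then show ?thesis using assms(2) by auto
  qed
  also have "\<dots> \<in> sets lebesgue" by (intro sets.countable_UN) (use N in auto)
  finally show ?thesis .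
qed

section \<open>Convex cones\<close>

text \<open>
  Scaling up a ball inside the cone gives balls of every radius inside it. This serves twice: a disc
  in the cone is where integrals are compared, and a point \<open>b\<close> that lies beyond all points of a
  bounded set lets \<open>\<rho> b\<close> bound the weight on that set from above.
\<close>

lemma convex_cone_absorbs_translate:
  fixes D :: "'a::euclidean_space set"
  assumes D: "convex_cone D" and "interior D \<noteq> {}"
  obtains b where "b \<in> D" "\<And>x. norm x \<le> R \<Longrightarrow> b + x \<in> D"
proof -
  from assms(2) obtain a \<eta> where \<eta>: "0 < \<eta>" and sub: "cball a \<eta> \<subseteq> D"
    by (auto simp: mem_interior_cball)
  define S where "S = max R 1"
  have S: "0 < S" "R \<le> S" by (auto simp: S_def)
  have mem: "(S / \<eta>) *\<^sub>R a + x \<in> D" if "norm x \<le> S" for x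
  proof -
    have "norm ((\<eta> / S) *\<^sub>R x) \<le> \<eta>"
      using S \<eta> that by (simp add: field_simps)
    then have "a + (\<eta> / S) *\<^sub>R x \<in> D" using sub by (auto simp: dist_norm)
    then have "(S / \<eta>) *\<^sub>R (a + (\<eta> / S) *\<^sub>R x) \<in> D"
      using D S \<eta> by (intro convex_cone_scaleR) auto
    then show ?thesis using S \<eta> by (simp add: scaleR_right_distrib)
  qed
  show ?thesis
  proof
    show "(S / \<eta>) *\<^sub>R a \<in> D" using mem[of 0] S by simp
    show "(S / \<eta>) *\<^sub>R a + x \<in> D" if "norm x \<le> R" for x using mem[of x] S that by simp
  qed
qed

text \<open>
  For \<open>z = r cis \<theta>\<close> with \<open>\<bar>\<theta>\<bar> \<le> \<pi>\<close> and \<open>r > 0\<close> the inequality says \<open>sin (\<bar>\<theta>\<bar> - \<alpha>) \<le> 0\<close>. Unlike a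
  condition on the slope \<open>Im z / Re z\<close>, it also describes the half plane \<open>\<alpha> = \<pi> / 2\<close>.
\<close>

lemma sector_eq_inequality:
  assumes "0 < \<alpha>" "\<alpha> \<le> pi / 2"
  shows "sector \<alpha> = {z. \<bar>Im z\<bar> * cos \<alpha> \<le> Re z * sin \<alpha>}"
proof (intro equalityI subsetI)
  have abs: "cos \<bar>\<theta>\<bar> = cos \<theta>" "\<bar>\<theta>\<bar> \<le> pi \<Longrightarrow> sin \<bar>\<theta>\<bar> = \<bar>sin \<theta>\<bar>" for \<theta> :: real
    using sin_ge_zero[of "\<bar>\<theta>\<bar>"] by (auto simp: abs_if split: if_splits)
  {
    fix z assume "z \<in> sector \<alpha>"
    then obtain r \<theta> where z: "z = of_real r * cis \<theta>" "0 \<le> r" "\<bar>\<theta>\<bar> \<le> \<alpha>"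
      by (auto simp: sector_def)
    have "0 \<le> sin (\<alpha> - \<bar>\<theta>\<bar>)" using z assms by (intro sin_ge_zero) auto
    then have "\<bar>sin \<theta>\<bar> * cos \<alpha> \<le> cos \<theta> * sin \<alpha>"
      using abs(2)[of \<theta>] z assms by (simp add: sin_diff abs(1) mult.commute)
    then have "r * (\<bar>sin \<theta>\<bar> * cos \<alpha>) \<le> r * (cos \<theta> * sin \<alpha>)"
      using z by (intro mult_left_mono)
    then show "z \<in> {z. \<bar>Im z\<bar> * cos \<alpha> \<le> Re z * sin \<alpha>}"
      using z by (simp add: abs_mult mult.assoc)
  next
    fix z assume "z \<in> {z. \<bar>Im z\<bar> * cos \<alpha> \<le> Re z * sin \<alpha>}"
    then have le: "\<bar>Im z\<bar> * cos \<alpha> \<le> Re z * sin \<alpha>" by simp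
    define r \<theta> where "r = norm z" and "\<theta> = Arg z"
    have z: "z = of_real r * cis \<theta>"
      unfolding r_def \<theta>_def by (metis rcis_cmod_Arg rcis_def)
    have \<theta>: "\<bar>\<theta>\<bar> \<le> pi" unfolding \<theta>_def using Arg_bounded[of z] by auto
    show "z \<in> sector \<alpha>"
    proof (cases "r = 0")
      case True
      then have "z = of_real 0 * cis 0" by (simp add: z)
      then show ?thesis using assms unfolding sector_def
        by (intro CollectI exI[of _ "0::real"] conjI) auto
    next
      case False
      then have r: "0 < r" by (simp add: r_def)
      have "\<bar>\<theta>\<bar> \<le> \<alpha>"
      proof (rule ccontr)
        assume "\<not> \<bar>\<theta>\<bar> \<le> \<alpha>"
        then have "0 < sin (\<bar>\<theta>\<bar> - \<alpha>)" using \<theta> assms by (intro sin_gt_zero) auto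
        then have "cos \<theta> * sin \<alpha> < \<bar>sin \<theta>\<bar> * cos \<alpha>"
          using abs(2)[OF \<theta>] by (simp add: sin_diff abs(1))
        then have "r * (cos \<theta> * sin \<alpha>) < r * (\<bar>sin \<theta>\<bar> * cos \<alpha>)"
          using r by (intro mult_strict_left_mono)
        then show False using le r by (simp add: z abs_mult mult.assoc)
      qed
      then show ?thesis using z r unfolding sector_def by force
    qed
  }
qed

lemma
  assumes "0 < \<alpha>" "\<alpha> \<le> pi / 2"
  shows closed_sector: "closed (sector \<alpha>)"
    and convex_cone_sector: "convex_cone (sector \<alpha>)"
    and interior_sector_nonempty: "interior (sector \<alpha>) \<noteq> {}"
proof -
  note eq = sector_eq_inequality[OF assms]
  have sin: "0 < sin \<alpha>" using assms by (intro sin_gt_zero) auto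
  have cos: "0 \<le> cos \<alpha>" "cos \<alpha> \<le> 1" using assms by (auto intro: cos_ge_zero)
  show "closed (sector \<alpha>)"
    unfolding eq by (intro closed_Collect_le continuous_intros)
  have add: "x + y \<in> sector \<alpha>" if "x \<in> sector \<alpha>" "y \<in> sector \<alpha>" for x y
  proof -
    have "\<bar>Im x + Im y\<bar> * cos \<alpha> \<le> (\<bar>Im x\<bar> + \<bar>Im y\<bar>) * cos \<alpha>"
      using cos by (intro mult_right_mono) auto
    then show ?thesis using that by (simp add: eq algebra_simps)
  qed
  have scale: "c *\<^sub>R x \<in> sector \<alpha>" if "x \<in> sector \<alpha>" "0 \<le> c" for x c
    using that mult_left_mono[of "\<bar>Im x\<bar> * cos \<alpha>" "Re x * sin \<alpha>" c]
    by (simp add: eq abs_mult mult.assoc)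
  show "convex_cone (sector \<alpha>)"
    unfolding convex_cone_iff using add scale by (auto simp: eq intro: exI[of _ 0])
  have "open {z. \<bar>Im z\<bar> * cos \<alpha> < Re z * sin \<alpha>}"
    by (intro open_Collect_less continuous_intros)
  moreover have "1 \<in> {z. \<bar>Im z\<bar> * cos \<alpha> < Re z * sin \<alpha>}" using sin by simp
  moreover have "{z. \<bar>Im z\<bar> * cos \<alpha> < Re z * sin \<alpha>} \<subseteq> sector \<alpha>" by (auto simp: eq)
  ultimately have "1 \<in> interior (sector \<alpha>)" by (rule interiorI)
  then show "interior (sector \<alpha>) \<noteq> {}" by blast
qed

section \<open>Admissible weights\<close>

lemma admissible_weight_le:
  assumes M: "1 \<le> M" and adm: "\<forall>t\<in>D. \<forall>t'\<in>D. \<rho> t \<le> M * exp (\<omega> * norm t') * \<rho> (t + t')"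
    and nn: "\<forall>t\<in>D. 0 \<le> \<rho> t"
    and s: "s \<in> D" "x \<in> D" "x - s \<in> D" "norm (x - s) \<le> r"
  shows "\<rho> s \<le> M * exp (\<bar>\<omega>\<bar> * r) * \<rho> x"
proof -
  have "\<rho> s \<le> M * exp (\<omega> * norm (x - s)) * \<rho> (s + (x - s))" using adm s by blast
  also have "\<dots> = M * exp (\<omega> * norm (x - s)) * \<rho> x" by simp
  also have "\<dots> \<le> M * exp (\<bar>\<omega>\<bar> * r) * \<rho> x"
  proof -
    have "\<omega> * norm (x - s) \<le> \<bar>\<omega>\<bar> * norm (x - s)" by (intro mult_right_mono) auto
    also have "\<dots> \<le> \<bar>\<omega>\<bar> * r" using s by (intro mult_left_mono) auto
    finally show ?thesis using M nn s by (intro mult_right_mono mult_left_mono) auto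
  qed
  finally show ?thesis .
qed

lemma admissible_weight_bounded:
  assumes D: "convex_cone D" "interior D \<noteq> {}" and adm: "admissible_weight D \<rho>"
  obtains C where "0 \<le> C" "\<And>x. x \<in> D \<Longrightarrow> norm x \<le> r \<Longrightarrow> \<rho> x \<le> C"
proof -
  obtain M \<omega> where M: "1 \<le> M" and le: "\<forall>t\<in>D. \<forall>t'\<in>D. \<rho> t \<le> M * exp (\<omega> * norm t') * \<rho> (t + t')"
    and nn: "\<forall>t\<in>D. 0 \<le> \<rho> t"
    using adm by (auto simp: admissible_weight_def)
  obtain b where b: "b \<in> D" "\<And>x. norm x \<le> r \<Longrightarrow> b + x \<in> D"
    using convex_cone_absorbs_translate[OF D, of r] by blast
  show ?thesis
  proof
    show "0 \<le> M * exp (\<bar>\<omega>\<bar> * (norm b + r)) * \<rho> b" using M nn b by simp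
    fix x assume x: "x \<in> D" "norm x \<le> r"
    have "b - x \<in> D" using b(2)[of "- x"] x by simp
    moreover have "norm (b - x) \<le> norm b + r" using x norm_triangle_ineq4[of b x] by linarith
    ultimately show "\<rho> x \<le> M * exp (\<bar>\<omega>\<bar> * (norm b + r)) * \<rho> b"
      using admissible_weight_le[OF M le nn x(1) b(1)] by blast
  qed
qed

text \<open>
  An admissible weight is bounded on bounded sets; it may be unbounded at infinity, but the plateau
  vanishes there.
\<close>

lemma plateau_in_Lp_functions:
  fixes c :: "'k::{real_normed_field,euclidean_space}"
  assumes D: "convex_cone D" "interior D \<noteq> {}" "D \<in> sets lebesgue"
    and adm: "admissible_weight D \<rho>" and p: "1 \<le> p"
  shows "(\<lambda>x. if norm x \<le> r then c else 0) \<in> Lp_functions D p \<rho>"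
proof -
  have [measurable]: "\<rho> \<in> borel_measurable (lebesgue_on D)" and nn: "\<forall>t\<in>D. 0 \<le> \<rho> t"
    using adm by (auto simp: admissible_weight_def)
  have [measurable]: "(\<lambda>x. norm (x::complex) \<le> r) \<in> measurable (lebesgue_on D) (count_space UNIV)"
  proof (rule measurable_restrict_space1)
    have "{x::complex. norm x \<le> r} = cball 0 r" by auto
    then show "Measurable.pred lebesgue (\<lambda>x::complex. norm x \<le> r)"
      unfolding pred_def by simp
  qed
  obtain C where C: "0 \<le> C" "\<And>x. x \<in> D \<Longrightarrow> norm x \<le> r \<Longrightarrow> \<rho> x \<le> C"
    using admissible_weight_bounded[OF D(1,2) adm, of r] by blast
  have "(\<lambda>x. indicator (cball 0 r) x :: real) absolutely_integrable_on D"
  proof -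
    have "integrable lebesgue (\<lambda>x. indicator (D \<inter> cball (0::complex) r) x :: real)"
    proof (rule integrable_real_indicator)
      have "emeasure lebesgue (D \<inter> cball 0 r) \<le> emeasure lebesgue (cball (0::complex) r)"
        by (intro emeasure_mono) auto
      also have "\<dots> < \<infinity>" using emeasure_bounded_finite[of "cball (0::complex) r"] by simp
      finally show "emeasure lebesgue (D \<inter> cball (0::complex) r) < \<infinity>" .
    qed (use D in auto)
    then show ?thesis
      unfolding set_integrable_def by (simp add: indicator_inter_arith)
  qed
  then have "integrable (lebesgue_on D) (\<lambda>x. norm c powr p * C * indicator (cball (0::complex) r) x)"
    using D by (intro integrable_mult_right) (auto simp: absolutely_integrable_on_def integrable_restrict_space set_integrable_def)
  then have "integrable (lebesgue_on D) (\<lambda>x. norm (if norm x \<le> r then c else 0) powr p * \<rho> x)"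
    by (rule Bochner_Integration.integrable_bound)
       (use C nn in \<open>auto intro!: AE_I2 mult_left_mono simp: abs_mult\<close>)
  then show ?thesis by (simp add: Lp_functions_def)
qed

section \<open>Orbits close to a plateau\<close>

text \<open>
  A number cannot be close both to \<open>c\<close> and to \<open>0\<close>: one of the two distances is at least \<open>c / 2\<close>.
\<close>

lemma half_powr_le_powr_sum:
  fixes y :: "'k::real_normed_field"
  assumes "0 \<le> c" "0 \<le> p"
  shows "(c / 2) powr p \<le> norm (y - of_real c) powr p + norm y powr p"
proof -
  have "c \<le> norm (y - of_real c) + norm y"
    using norm_triangle_ineq4[of y "y - of_real c"] assms by simp
  then consider "c / 2 \<le> norm (y - of_real c)" | "c / 2 \<le> norm y" by linarith
  then show ?thesis
  proof cases
    case 1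
    then have "(c / 2) powr p \<le> norm (y - of_real c) powr p" using assms by (intro powr_mono2) auto
    then show ?thesis by (simp add: add_increasing2)
  next
    case 2
    then have "(c / 2) powr p \<le> norm y powr p" using assms by (intro powr_mono2) auto
    then show ?thesis by (simp add: add_increasing)
  qed
qed

text \<open>
  On \<open>E\<close>, where \<open>v\<close> equals \<open>c\<close>, the preceding inequality is applied to \<open>y = f (x + t)\<close> and
  integrated. The first term is controlled through the weight at \<open>x\<close> by the distance from the
  translate to \<open>v\<close>; the second is controlled through the weight at \<open>x + t\<close> and translation
  invariance by the norm of \<open>f\<close>. Thus a high plateau can be approximated by a translate only where
  the weight at \<open>x + t\<close> is small.
\<close>

lemma translate_near_plateau_bound:
  fixes f v :: "complex \<Rightarrow> 'k::{real_normed_field,euclidean_space}"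
  assumes D: "D \<in> sets lebesgue" and p: "1 \<le> p"
    and \<rho>: "\<rho> \<in> borel_measurable (lebesgue_on D)" "\<And>x. x \<in> D \<Longrightarrow> 0 \<le> \<rho> x"
    and f: "f \<in> Lp_functions D p \<rho>"
    and h: "(\<lambda>x. f (x + t) - v x) \<in> Lp_functions D p \<rho>"
    and E: "E \<in> lmeasurable" "E \<subseteq> D" "\<And>x. x \<in> E \<Longrightarrow> x + t \<in> D"
    and c: "0 \<le> c" "\<And>x. x \<in> E \<Longrightarrow> v x = of_real c"
    and A: "0 \<le> A" "\<And>x. x \<in> E \<Longrightarrow> 1 \<le> A * \<rho> x"
    and B: "0 \<le> B" "\<And>x. x \<in> E \<Longrightarrow> 1 \<le> B * \<rho> (x + t)"
  shows "(c / 2) powr p * measure lebesgue E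
    \<le> A * (LINT x|lebesgue_on D. norm (f (x + t) - v x) powr p * \<rho> x)
      + B * (LINT x|lebesgue_on D. norm (f x) powr p * \<rho> x)"
proof -
  \<comment> \<open>Extending by \<open>0\<close> to the whole plane makes translation invariance of the integral applicable.\<close>
  define F where "F = (\<lambda>x. ennreal (norm (f x) powr p * \<rho> x) * indicator D x)"
  define H where "H = (\<lambda>x. ennreal (norm (f (x + t) - v x) powr p * \<rho> x) * indicator D x)"
  let ?IF = "LINT x|lebesgue_on D. norm (f x) powr p * \<rho> x"
  let ?IH = "LINT x|lebesgue_on D. norm (f (x + t) - v x) powr p * \<rho> x"
  have intF: "integrable (lebesgue_on D) (\<lambda>x. norm (f x) powr p * \<rho> x)"
    and intH: "integrable (lebesgue_on D) (\<lambda>x. norm (f (x + t) - v x) powr p * \<rho> x)"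
    using f h by (auto simp: Lp_functions_def)
  have ext: "(\<lambda>x. ennreal (g x) * indicator D x) \<in> borel_measurable lebesgue"
      "(\<integral>\<^sup>+x. ennreal (g x) * indicator D x \<partial>lebesgue) = ennreal (LINT x|lebesgue_on D. g x)"
    if "integrable (lebesgue_on D) g" "\<And>x. x \<in> D \<Longrightarrow> 0 \<le> g x" for g :: "complex \<Rightarrow> real"
  proof -
    have "(\<lambda>x. ennreal (g x)) \<in> borel_measurable (lebesgue_on D)" using that by measurable
    then show "(\<lambda>x. ennreal (g x) * indicator D x) \<in> borel_measurable lebesgue"
      using D by (subst (asm) borel_measurable_restrict_space_iff_ennreal) auto
    show "(\<integral>\<^sup>+x. ennreal (g x) * indicator D x \<partial>lebesgue) = ennreal (LINT x|lebesgue_on D. g x)"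
      using that D nn_integral_eq_integral[OF that(1)]
      by (simp add: nn_integral_restrict_space AE_restrict_space_iff)
  qed
  have F: "F \<in> borel_measurable lebesgue" "(\<integral>\<^sup>+x. F x \<partial>lebesgue) = ennreal ?IF"
    and H: "H \<in> borel_measurable lebesgue" "(\<integral>\<^sup>+x. H x \<partial>lebesgue) = ennreal ?IH"
    unfolding F_def H_def using ext[OF intF] ext[OF intH] \<rho>(2) by auto
  have Ft: "(\<lambda>x. F (x + t)) \<in> borel_measurable lebesgue"
    by (rule measurable_compose[OF distr_lebesgue_translation(1) F(1)])
  have I0: "0 \<le> ?IF" "0 \<le> ?IH"
    using \<rho>(2) by (auto intro!: integral_nonneg_AE AE_I2)
  have pt: "ennreal ((c / 2) powr p) * indicator E x \<le> ennreal A * H x + ennreal B * F (x + t)" for x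
  proof (cases "x \<in> E")
    case True
    then have xD: "x \<in> D" "x + t \<in> D" using E by auto
    let ?a = "norm (f (x + t) - v x) powr p" and ?b = "norm (f (x + t)) powr p"
    have "(c / 2) powr p \<le> ?a * 1 + ?b * 1"
      using half_powr_le_powr_sum[of c p "f (x + t)"] c True p by simp
    also have "\<dots> \<le> ?a * (A * \<rho> x) + ?b * (B * \<rho> (x + t))"
      using A(2)[OF True] B(2)[OF True] by (intro add_mono mult_left_mono) auto
    also have "\<dots> = A * (?a * \<rho> x) + B * (?b * \<rho> (x + t))" by (simp add: algebra_simps)
    finally have "ennreal ((c / 2) powr p) \<le> ennreal (A * (?a * \<rho> x) + B * (?b * \<rho> (x + t)))"
      by (rule ennreal_leI)
    also have "\<dots> = ennreal A * H x + ennreal B * F (x + t)"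
      using xD A B \<rho>(2) by (simp add: H_def F_def ennreal_plus ennreal_mult)
    finally show ?thesis using True by simp
  qed simp
  have "ennreal ((c / 2) powr p * measure lebesgue E) = (\<integral>\<^sup>+x. ennreal ((c / 2) powr p) * indicator E x \<partial>lebesgue)"
    using E by (simp add: nn_integral_cmult_indicator emeasure_eq_measure2 fmeasurableD ennreal_mult)
  also have "\<dots> \<le> (\<integral>\<^sup>+x. ennreal A * H x + ennreal B * F (x + t) \<partial>lebesgue)"
    by (intro nn_integral_mono pt)
  also have "\<dots> = ennreal A * ennreal ?IH + ennreal B * ennreal ?IF"
    using F H Ft by (simp add: nn_integral_add nn_integral_cmult nn_integral_lebesgue_translation)
  also have "\<dots> = ennreal (A * ?IH + B * ?IF)"
    using A B I0 by (simp add: ennreal_plus ennreal_mult)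
  finally show ?thesis using A B I0 by (subst (asm) ennreal_le_iff) auto
qed

text \<open>
  The class of a translate is a union over all representatives of the original class, so it is
  nonempty only if the translate of some representative is again of finite norm. The representative
  may vary with \<open>t\<close>, but all representatives have the same norm.
\<close>

lemma translation_representative:
  assumes p: "1 \<le> p" and \<rho>: "\<rho> \<in> borel_measurable (lebesgue_on D)" "\<And>x. x \<in> D \<Longrightarrow> 0 \<le> \<rho> x"
    and T: "translation D p \<rho> t F \<in> Lp_space D p \<rho>"
  obtains f where "f \<in> F" "(\<lambda>x. f (x + t)) \<in> translation D p \<rho> t F"
proof -
  note eq = equiv_Lp_rel[of p \<rho> D, OF p \<rho>]
  obtain g where "g \<in> translation D p \<rho> t F"
    using T in_quotient_imp_non_empty[OF eq] unfolding Lp_space_def by blast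
  then obtain f where f: "f \<in> F" "(\<lambda>x. f (x + t), g) \<in> Lp_rel D p \<rho>"
    by (auto simp: translation_def)
  then have "(\<lambda>x. f (x + t), \<lambda>x. f (x + t)) \<in> Lp_rel D p \<rho>" by (auto simp: Lp_rel_def)
  then have "(\<lambda>x. f (x + t)) \<in> translation D p \<rho> t F"
    using f by (auto simp: translation_def)
  with f(1) show ?thesis by (rule that)
qed

section \<open>Thickness of the sublevel sets\<close>

theorem frequently_hypercyclic_translation_imp_thick_sublevel:
  fixes \<rho> :: "complex \<Rightarrow> real"
  assumes D: "convex_cone D" "interior D \<noteq> {}" "D \<in> sets lebesgue"
    and p: "1 \<le> p" and adm: "admissible_weight D \<rho>"
    and fhc: "frequently_hypercyclic D (Lp_topology D p \<rho>)
      (translation D p \<rho> :: complex \<Rightarrow> (complex \<Rightarrow> 'k::{real_normed_field,euclidean_space}) set \<Rightarrow> _)"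
    and \<epsilon>: "0 < \<epsilon>"
  shows "thick_pld_set D {t \<in> D. \<rho> t \<le> \<epsilon>}"
  unfolding thick_pld_set_def
proof (intro conjI allI impI)
  fix K assume K: "compact K \<and> K \<subseteq> D"
  let ?T = "translation D p \<rho> :: complex \<Rightarrow> (complex \<Rightarrow> 'k) set \<Rightarrow> _"
  let ?X = "Lp_space D p \<rho> :: (complex \<Rightarrow> 'k) set set"
  let ?I = "\<lambda>h::complex \<Rightarrow> 'k. LINT x|lebesgue_on D. norm (h x) powr p * \<rho> x"
  obtain M \<omega> where M: "1 \<le> M"
    and le: "\<forall>t\<in>D. \<forall>t'\<in>D. \<rho> t \<le> M * exp (\<omega> * norm t') * \<rho> (t + t')"
    and \<rho>m: "\<rho> \<in> borel_measurable (lebesgue_on D)" and nn: "\<forall>t\<in>D. 0 \<le> \<rho> t"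
    using adm by (auto simp: admissible_weight_def)
  have \<rho>: "\<rho> \<in> borel_measurable (lebesgue_on D)" "\<And>x. x \<in> D \<Longrightarrow> 0 \<le> \<rho> x"
    using \<rho>m nn by auto
  note weight_le = admissible_weight_le[OF M le nn]
  note eq = equiv_Lp_rel[of p \<rho> D, OF p \<rho>]
  interpret Metric_space ?X "Lp_dist D p \<rho>" by (rule Metric_space_Lp[OF p \<rho>])
  have top: "Lp_topology D p \<rho> = mtopology" by (simp add: Lp_topology_def)
  obtain u where u: "u \<in> ?X"
    and dense: "\<And>U. openin mtopology U \<Longrightarrow> U \<noteq> {} \<Longrightarrow> 0 < lower_density D {t \<in> D. ?T t u \<in> U}"
    using fhc unfolding frequently_hypercyclic_def top by auto
  obtain f0 where f0: "f0 \<in> u"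
    using u in_quotient_imp_non_empty[OF eq] unfolding Lp_space_def by blast
  have uL: "f \<in> Lp_functions D p \<rho>" if "f \<in> u" for f
    using u that in_quotient_imp_subset[OF eq] unfolding Lp_space_def by blast
  have norm_u: "?I f = ?I f0" if "f \<in> u" for f
  proof -
    have "(f, f0) \<in> Lp_rel D p \<rho>"
      using quotient_eq_iff[OF eq, of u u f f0] u that f0 unfolding Lp_space_def by blast
    then have "AE x in lebesgue_on D. norm (f x) powr p * \<rho> x = norm (f0 x) powr p * \<rho> x"
      by (auto simp: Lp_rel_def elim!: AE_mp)
    then show ?thesis
      using uL[OF that] uL[OF f0] by (intro integral_cong_AE) (auto simp: Lp_functions_def)
  qed
  define I where "I = ?I f0"
  have add: "k + t \<in> D" if "k \<in> K" "t \<in> D" for k t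
    using that K convex_cone_add[OF D(1)] by blast
  have I0: "0 \<le> I" unfolding I_def using \<rho>(2) by (auto intro!: integral_nonneg_AE AE_I2)

  show "\<exists>B\<in>pos_lower_density_sets D. {k + b |k b. k \<in> K \<and> b \<in> B} \<subseteq> {t \<in> D. \<rho> t \<le> \<epsilon>}"
  proof (cases "\<forall>s\<in>D. \<rho> s = 0")
    case True
    let ?B = "{t \<in> D. ?T t u \<in> ?X}"
    have "0 < lower_density D ?B" using dense[of ?X] u using openin_topspace[of mtopology] by auto
    then have "?B \<in> pos_lower_density_sets D"
      using lower_density_pos_imp_measurable[of D ?B] by (auto simp: pos_lower_density_sets_def)
    moreover have "{k + b |k b. k \<in> K \<and> b \<in> ?B} \<subseteq> {t \<in> D. \<rho> t \<le> \<epsilon>}"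
      using True \<epsilon> add by fastforce
    ultimately show ?thesis by blast
  next
    case False
    then obtain s where s: "s \<in> D" "0 < \<rho> s" using \<rho>(2) by force
    obtain b where b: "\<And>x. norm x \<le> 1 \<Longrightarrow> b + x \<in> D"
      using convex_cone_absorbs_translate[OF D(1,2)] by metis
    obtain R where R: "\<And>k. k \<in> K \<Longrightarrow> norm k \<le> R"
      using K compact_imp_bounded bounded_iff by metis
    \<comment> \<open>\<open>a\<close> bounds \<open>1 / \<rho> x\<close> on every disc \<open>E\<close> of radius 1 around \<open>k + s + b\<close> with \<open>k\<close> in \<open>K\<close>;
      \<open>C\<close> bounds \<open>1 / \<rho> (x + t)\<close> there if \<open>\<rho> (k + t) > \<epsilon>\<close>.\<close>
    define a where "a = M * exp (\<bar>\<omega>\<bar> * (R + norm b + 1)) / \<rho> s"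
    define C where "C = M * exp (\<bar>\<omega>\<bar> * (norm s + norm b + 1)) / \<epsilon>"
    define m where "m = measure lebesgue (cball (0::complex) 1)"
    have pos: "0 < a" "0 < C" "0 < m"
      using M s \<epsilon> by (auto simp: a_def C_def m_def content_cball_pos measure_completion)
    define J where "J = (a + C * I) / m"
    have J: "0 \<le> J" using pos I0 by (simp add: J_def)
    \<comment> \<open>If \<open>\<rho> (k + t) > \<epsilon>\<close>, then \<open>(c / 2) powr p\<close> is at most \<open>J\<close>; the height is chosen to make it
      equal to \<open>J + 1\<close>.\<close>
    define c where "c = 2 * (J + 1) powr (1 / p)"
    have c: "0 \<le> c" "J < (c / 2) powr p" using J p by (auto simp: c_def powr_powr)
    \<comment> \<open>The plateau is wide enough to contain all the discs \<open>E\<close>.\<close>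
    define v where "v = (\<lambda>x::complex. if norm x \<le> R + norm s + norm b + 1 then of_real c else (0::'k))"
    have v: "v \<in> Lp_functions D p \<rho>" unfolding v_def by (rule plateau_in_Lp_functions[OF D adm p])
    define V where "V = Lp_rel D p \<rho> `` {v}"
    have V: "V \<in> ?X" "v \<in> V"
      using quotientI[OF v] equiv_class_self[OF eq v] unfolding V_def Lp_space_def by auto
    define B where "B = {t \<in> D. ?T t u \<in> mball V 1}"
    have "mball V 1 \<noteq> {}" using centre_in_mball_iff[of V 1] V by force
    then have "0 < lower_density D B"
      unfolding B_def by (rule dense[OF openin_mball])
    then have B: "B \<in> pos_lower_density_sets D"
      using lower_density_pos_imp_measurable[of D B] by (auto simp: pos_lower_density_sets_def B_def)
    have small: "\<rho> (k + t) \<le> \<epsilon>" if k: "k \<in> K" and t: "t \<in> B" for k t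
    proof (rule ccontr)
      assume "\<not> \<rho> (k + t) \<le> \<epsilon>"
      then have big: "\<epsilon> < \<rho> (k + t)" by simp
      have tD: "t \<in> D" and Tt: "?T t u \<in> ?X" "Lp_dist D p \<rho> V (?T t u) < 1"
        using t by (auto simp: B_def)
      obtain f where f: "f \<in> u" "(\<lambda>x. f (x + t)) \<in> ?T t u"
        using translation_representative[OF p \<rho> Tt(1)] .
      have fL: "(\<lambda>x. f (x + t)) \<in> Lp_functions D p \<rho>"
        using Tt(1) f(2) in_quotient_imp_subset[OF eq] unfolding Lp_space_def by blast
      have h: "(\<lambda>x. f (x + t) - v x) \<in> Lp_functions D p \<rho>"
        by (rule Lp_functions_diff_bound(1)[OF p \<rho> fL v zero_less_one zero_less_one])
      have "Lp_norm D p \<rho> (\<lambda>x. f (x + t) - v x) < 1"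
        using Lp_dist_eq[OF p \<rho> Tt(1) V(1) f(2) V(2)] Tt(2) commute[of V "?T t u"] by simp
      then have close: "?I (\<lambda>x. f (x + t) - v x) \<le> 1"
        using p ge_one_powr_ge_zero[of "?I (\<lambda>x. f (x + t) - v x)" "1 / p"]
        by (intro leI notI) (simp add: Lp_norm_def)
      define E where "E = cball (k + s + b) (1::real)"
      have E: "x - k - s \<in> D" "x - s \<in> D" "x - k \<in> D" "x \<in> D" "norm (x - s) \<le> R + norm b + 1"
          "norm (x - k) \<le> norm s + norm b + 1" "norm x \<le> R + norm s + norm b + 1" if "x \<in> E" for x
      proof -
        define y where "y = x - (k + s + b)"
        have y: "norm y \<le> 1" "x = k + s + b + y" using that by (auto simp: E_def y_def dist_norm norm_minus_commute)
        have kD: "k \<in> D" "norm k \<le> R" using k K R by auto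
        have byD: "b + y \<in> D" by (rule b[OF y(1)])
        show 1: "x - k - s \<in> D" using byD by (simp add: y(2) algebra_simps)
        show 2: "x - s \<in> D" using convex_cone_add[OF D(1) kD(1) byD] by (simp add: y(2) algebra_simps)
        show "x - k \<in> D" using convex_cone_add[OF D(1) s(1) byD] by (simp add: y(2) algebra_simps)
        show "x \<in> D" using convex_cone_add[OF D(1) s(1) 2] by simp
        have n: "norm (b + y) \<le> norm b + 1" using y(1) norm_triangle_ineq[of b y] by linarith
        have "x - s = k + (b + y)" "x - k = s + (b + y)" "x = k + s + (b + y)" by (simp_all add: y(2))
        then show "norm (x - s) \<le> R + norm b + 1" "norm (x - k) \<le> norm s + norm b + 1"
            "norm x \<le> R + norm s + norm b + 1"
          using n kD norm_triangle_ineq[of k "b + y"] norm_triangle_ineq[of s "b + y"]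
            norm_triangle_ineq[of "k + s" "b + y"] norm_triangle_ineq[of k s] by force+
      qed
      have xt: "x + t \<in> D" if "x \<in> E" for x using convex_cone_add[OF D(1) E(4)[OF that] tD] .
      have mE: "measure lebesgue E = m"
        unfolding E_def m_def
        using measure_translation[of "k + s + b" "cball (0::complex) 1"] by (simp add: cball_translation[symmetric])
      have "(c / 2) powr p * measure lebesgue E \<le> a * ?I (\<lambda>x. f (x + t) - v x) + C * ?I f"
      proof (rule translate_near_plateau_bound[OF D(3) p \<rho> uL[OF f(1)] h])
        show "E \<in> lmeasurable" by (simp add: E_def)
        show "E \<subseteq> D" using E by blast
        show "v x = of_real c" if "x \<in> E" for x using E(7)[OF that] by (simp add: v_def)
        show "1 \<le> a * \<rho> x" if "x \<in> E" for x
          using weight_le[OF s(1) E(4)[OF that] E(2)[OF that] E(5)[OF that]] s(2)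
          by (simp add: a_def field_simps)
        show "1 \<le> C * \<rho> (x + t)" if "x \<in> E" for x
        proof -
          have "k + t \<in> D" using add[OF k tD] .
          moreover have "x + t - (k + t) = x - k" by simp
          ultimately have "\<rho> (k + t) \<le> M * exp (\<bar>\<omega>\<bar> * (norm s + norm b + 1)) * \<rho> (x + t)"
            using weight_le[of "k + t" "x + t"] xt[OF that] E(3,6)[OF that] by metis
          then show ?thesis using big \<epsilon> by (simp add: C_def field_simps)
        qed
      qed (use c pos xt in auto)
      also have "\<dots> \<le> a + C * I"
        using close pos norm_u[OF f(1)] mult_left_mono[of _ 1 a] by (force simp: I_def)
      finally have "(c / 2) powr p \<le> J" using pos by (simp add: mE J_def field_simps)
      with c show False by simp
    qed
    have "{k + b |k b. k \<in> K \<and> b \<in> B} \<subseteq> {t \<in> D. \<rho> t \<le> \<epsilon>}"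
      using small by (auto simp: B_def intro: add)
    with B show ?thesis by blast
  qed
qed auto

(* A real normed field of finite dimension is isometrically isomorphic to the reals or the
   complex numbers, so the type 'k stands for either of the two. *)
theorem proposition3p5:
  fixes \<alpha> p \<epsilon> :: real
    and \<Delta> :: "complex set"
    and \<rho> :: "complex \<Rightarrow> real"
    and T :: "complex \<Rightarrow> (complex \<Rightarrow> 'k::{real_normed_field,euclidean_space}) set \<Rightarrow> (complex \<Rightarrow> 'k) set"
  assumes "0 < \<alpha>" and "\<alpha> \<le> pi / 2"
    and "\<Delta> = sector \<alpha>"
    and "1 \<le> p"
    and "admissible_weight \<Delta> \<rho>"
    and "T = translation \<Delta> p \<rho>"
    and "frequently_hypercyclic \<Delta> (Lp_topology \<Delta> p \<rho>) T"
    and "\<epsilon> > 0"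
  shows "thick_pld_set \<Delta> {t \<in> \<Delta>. \<rho> t \<le> \<epsilon>}"
proof (rule frequently_hypercyclic_translation_imp_thick_sublevel)
  show "convex_cone \<Delta>" "interior \<Delta> \<noteq> {}"
    using assms convex_cone_sector interior_sector_nonempty by auto
  show "\<Delta> \<in> sets lebesgue"
    using closed_sector[OF assms(1,2)] assms(3) by (simp add: borel_closed)
  show "frequently_hypercyclic \<Delta> (Lp_topology \<Delta> p \<rho>)
      (translation \<Delta> p \<rho> :: complex \<Rightarrow> (complex \<Rightarrow> 'k) set \<Rightarrow> _)"
    using assms by blast
qed (use assms in auto)

end
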